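(* Let $u(n)=\sum_{j=0}^n\binom nj^2\binom{2j}j\binom{2n-2j}{n-j}$ for $n\ge0$. Then $\{u(n)\}$ is the sequence determined by $u(0)=1$ and $(n+1)^3u(n+1)=(2n+1)(10n^2+10n+4)u(n)-64n^3u(n-1)$ for $n\ge0$, and in a neighborhood of $x=0$, $$\sum_{n=0}^\infty\binom{2n}{n}\frac{x^n}{(1-4x)^{n+1/2}}\sum_{k=0}^n\binom nk^2\binom{n+k}{k}x^k=\sum_{n=0}^\infty u(n)x^n.$$
   Context: $(1-4x)^{n+1/2}$ denotes the principal branch (equal to $1$ at $x=0$). *)

theory Defs
  imports "HOL-Analysis.Analysis"
begin

definition u :: "nat \<Rightarrow> nat" where
  "u n = (\<Sum>j=0..n. (n choose j)\<^sup>2 * ((2 * j) choose j) * ((2 * n - 2 * j) choose (n - j)))"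

text \<open>For \<open>n = 0\<close> the term \<open>v (n - 1)\<close> (truncated subtraction) is irrelevant, as its coefficient is \<open>0\<close>.\<close>
definition satisfies_rec :: "(nat \<Rightarrow> complex) \<Rightarrow> bool" where
  "satisfies_rec v \<longleftrightarrow> v 0 = 1 \<and>
     (\<forall>n::nat. (of_nat n + 1) ^ 3 * v (n + 1) =
        (2 * of_nat n + 1) * (10 * of_nat n ^ 2 + 10 * of_nat n + 4) * v n
          - 64 * of_nat n ^ 3 * v (n - 1))"

text \<open>Complex \<open>powr\<close> is \<open>exp (a * Ln z)\<close> with the principal logarithm,
  so \<open>(1 - 4 * x) powr a\<close> is the branch equal to \<open>1\<close> at \<open>x = 0\<close>.\<close>
definition lhs_term :: "complex \<Rightarrow> nat \<Rightarrow> complex" where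
  "lhs_term x n =
     of_nat ((2 * n) choose n) * (x ^ n / (1 - 4 * x) powr (of_nat n + 1 / 2)) *
       (\<Sum>k=0..n. of_nat ((n choose k)\<^sup>2 * ((n + k) choose k)) * x ^ k)"

end

theory Submission
  imports Defs
begin

text \<open>
  Expanding \<open>(1 - 4x)\<^bsup>-n-1/2\<^esup>\<close> by the binomial theorem turns the left-hand side into a triple power
  series with nonnegative integer coefficients, and the coefficient of \<open>x\<^sup>p\<close> is the double sum
  \[\sum_{k,n} \binom{2p-2k}{p-k}\binom{p-k}{n}\binom nk^2\binom{n+k}{k}.\]
  Creative telescoping shows that this double sum and \<open>u\<close> satisfy the same recurrence, so they agree.
  Since \<open>u p \<le> 16\<^sup>p\<close>, the triple series converges absolutely for \<open>|x| < 1/16\<close> and may be rearranged.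
\<close>

section \<open>Reciprocal factorials and half-integer Gamma values\<close>

text \<open>Extending \<open>1 / z!\<close> by \<open>0\<close> to negative \<open>z\<close> keeps \<open>rfact (z - 1) = z * rfact z\<close> valid for all
  integers, so the telescoping identities below hold at the boundary of the summation range without
  case distinctions.\<close>
definition rfact :: "int \<Rightarrow> real" where
  "rfact z = (if z < 0 then 0 else 1 / fact (nat z))"

lemma rfact_of_nat [simp]: "rfact (int n) = 1 / fact n"
  by (simp add: rfact_def)

lemma rfact_neg [simp]: "z < 0 \<Longrightarrow> rfact z = 0"
  by (simp add: rfact_def)

lemma rfact_minus_one: "rfact (z - 1) = of_int z * rfact z"
proof (cases "z > 0")
  case True
  then have "nat z = Suc (nat (z - 1))" by simp
  then have "fact (nat z) = (of_int z * fact (nat (z - 1)) :: real)"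
    using True by (simp add: algebra_simps)
  then show ?thesis using True by (simp add: rfact_def)
qed (auto simp: rfact_def)

text \<open>\<open>hfac z\<close> is \<open>(2z)! / z!\<close>, continued to negative \<open>z\<close> by the Gamma function.\<close>
definition hfac :: "int \<Rightarrow> real" where
  "hfac z = 4 powi z * Gamma (of_int z + 1 / 2) / sqrt pi"

text \<open>Functional equation of \<open>Gamma\<close>; half-integers avoid its poles, so negative
  \<open>z\<close> are covered too.\<close>

lemma hfac_plus_one: "hfac (z + 1) = (4 * of_int z + 2) * hfac z"
proof -
  have "(of_int z + 1 / 2 :: real) \<notin> \<int>\<^sub>\<le>\<^sub>0"
  proof
    assume "(of_int z + 1 / 2 :: real) \<in> \<int>\<^sub>\<le>\<^sub>0"
    then obtain k :: int where "of_int z + 1 / 2 = (of_int k :: real)"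
      by (auto elim!: nonpos_Ints_cases)
    then have "of_int (2 * z + 1) = (of_int (2 * k) :: real)" by simp
    then have "2 * z + 1 = 2 * k" by (simp only: of_int_eq_iff)
    then show False by presburger
  qed
  then have "Gamma (of_int z + 1 / 2 + 1 :: real) = (of_int z + 1 / 2) * Gamma (of_int z + 1 / 2)"
    by (intro Gamma_plus1) auto
  moreover have "of_int (z + 1) + 1 / 2 = (of_int z + 1 / 2 + 1 :: real)"
    by simp
  ultimately have "Gamma (of_int (z + 1) + 1 / 2 :: real) = (of_int z + 1 / 2) * Gamma (of_int z + 1 / 2)"
    by (simp only:)
  moreover have "4 powi (z + 1) = 4 * (4 powi z :: real)"
    by (simp add: power_int_add)
  ultimately show ?thesis
    unfolding hfac_def by (simp only:) (simp add: algebra_simps)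
qed

lemma hfac_of_nat: "hfac (int j) = fact (2 * j) / fact j"
proof (induction j)
  case 0
  then show ?case by (simp add: hfac_def Gamma_one_half_real)
next
  case (Suc j)
  have "hfac (int (Suc j)) = (4 * real j + 2) * (fact (2 * j) / fact j)"
    using hfac_plus_one[of "int j"] Suc by (simp add: add.commute)
  also have "\<dots> = ((2 * real j + 2) * (2 * real j + 1) * fact (2 * j)) / ((real j + 1) * fact j)"
    by (simp add: divide_simps) algebra
  also have "\<dots> = fact (2 * Suc j) / fact (Suc j)"
    by (simp add: algebra_simps)
  finally show ?case .
qed

lemma hfac_eq_minus_one: "hfac z = (4 * of_int z - 2) * hfac (z - 1)"
  using hfac_plus_one[of "z - 1"] by simp

section \<open>Recurrence for \<open>u\<close>\<close>

text \<open>Since \<open>2 * j choose j\<close> is \<open>hfac (int j) * rfact (int j)\<close>, it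
  adds one \<open>rfact (int j)\<close> to the two from the squared binomial, whence the
  cubes.\<close>

definition domb_term :: "nat \<Rightarrow> nat \<Rightarrow> real" where
  "domb_term n j = fact n ^ 2 * rfact (int j) ^ 3 * rfact (int n - int j) ^ 3 *
     hfac (int j) * hfac (int n - int j)"

lemma domb_term_eq_0: "j > n \<Longrightarrow> domb_term n j = 0"
  by (simp add: domb_term_def)

lemma domb_term_eq:
  assumes "j \<le> n"
  shows "domb_term n j = real ((n choose j)\<^sup>2 * (2 * j choose j) * (2 * n - 2 * j choose (n - j)))"
proof -
  obtain m where n: "n = j + m" using assms le_Suc_ex by blast
  have "2 * n - 2 * j = 2 * m" by (simp add: n)
  moreover have "real (2 * j choose j) = fact (2 * j) / (fact j * fact j)"
    "real (2 * m choose m) = fact (2 * m) / (fact m * fact m)"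
    "real (n choose j) = fact n / (fact j * fact m)"
    by (simp_all add: binomial_fact n)
  moreover have "int n - int j = int m" by (simp add: n)
  ultimately show ?thesis
    by (simp add: domb_term_def hfac_of_nat n power2_eq_square power3_eq_cube)
qed

text \<open>The bound \<open>M\<close> is free so that three consecutive values of \<open>u\<close>
  share one summation range.\<close>

lemma u_eq_sum_domb_term:
  assumes "n \<le> M"
  shows "real (u n) = (\<Sum>j\<le>M. domb_term n j)"
proof -
  have "real (u n) = (\<Sum>j\<le>n. domb_term n j)"
    unfolding u_def of_nat_sum atMost_atLeast0 by (intro sum.cong) (auto simp: domb_term_eq)
  also have "\<dots> = (\<Sum>j\<le>M. domb_term n j)"
    using assms by (intro sum.mono_neutral_left) (auto simp: domb_term_eq_0)
  finally show ?thesis .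
qed

text \<open>The cubic polynomial was found by solving the linear system for its coefficients that
  \<open>domb_term_telescopes\<close> amounts to.\<close>
definition domb_cert :: "nat \<Rightarrow> nat \<Rightarrow> real" where
  "domb_cert n j =
     (8 * real j ^ 3 - 24 * real j ^ 2 + 22 * real j - 4
       + real n * (- 36 * real j ^ 2 + 74 * real j - 32)
       + real n ^ 2 * (52 * real j - 52) - 24 * real n ^ 3) *
     (fact n ^ 2 * rfact (int j - 1) ^ 3 * rfact (int n + 1 - int j) ^ 3 *
       hfac (int j) * hfac (int n - int j))"

text \<open>Every factor is a polynomial multiple of a few base values, which leaves a polynomial
  identity.\<close>

lemma domb_term_telescopes:
  fixes m j :: nat
  defines "n \<equiv> m + 1"
  shows "(real n + 1) ^ 3 * domb_term (n + 1) j
    - (2 * real n + 1) * (10 * real n ^ 2 + 10 * real n + 4) * domb_term n j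
    + 64 * real n ^ 3 * domb_term m j = domb_cert n (Suc j) - domb_cert n j"
proof -
  define x where "x = real j"
  define N where "N = real n"
  define f where "f = (fact m :: real)"
  define a where "a = rfact (int j)"
  \<comment> \<open>The base values take the largest shift of \<open>rfact\<close> and the smallest
    of \<open>hfac\<close>, so that \<open>rfact_minus_one\<close> and \<open>hfac_plus_one\<close>
    reach the other shifts without division.\<close>
  define b where "b = rfact (int n + 1 - int j)"
  define g where "g = hfac (int j)"
  define h where "h = hfac (int n - int j - 1)"
  have fn: "fact n = N * f" "fact (n + 1) = (N + 1) * (N * f)"
    by (simp_all add: n_def N_def f_def algebra_simps)
  have r1: "rfact (int n - int j) = (N + 1 - x) * b"
    using rfact_minus_one[of "int n + 1 - int j"] by (simp add: b_def N_def x_def)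
  have r2: "rfact (int m - int j) = (N - x) * ((N + 1 - x) * b)"
    using rfact_minus_one[of "int n - int j"] r1 by (simp add: N_def x_def n_def)
  have r3: "rfact (int j - 1) = x * a"
    using rfact_minus_one[of "int j"] by (simp add: x_def a_def)
  have h1: "hfac (int n - int j) = (4 * (N - x) - 2) * h"
    using hfac_eq_minus_one[of "int n - int j"] by (simp add: h_def N_def x_def)
  have h2: "hfac (int n + 1 - int j) = (4 * (N - x) + 2) * ((4 * (N - x) - 2) * h)"
    using hfac_plus_one[of "int n - int j"] h1 by (simp add: N_def x_def algebra_simps)
  have h3: "hfac (int j + 1) = (4 * x + 2) * g"
    using hfac_plus_one[of "int j"] by (simp add: g_def x_def)
  have t1: "domb_term (n + 1) j = ((N + 1) * (N * f)) ^ 2 * a ^ 3 * b ^ 3 * g *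
      ((4 * (N - x) + 2) * ((4 * (N - x) - 2) * h))"
    unfolding domb_term_def fn of_nat_add of_nat_1 h2 a_def b_def g_def ..
  have t2: "domb_term n j = (N * f) ^ 2 * a ^ 3 * ((N + 1 - x) * b) ^ 3 * g *
      ((4 * (N - x) - 2) * h)"
    unfolding domb_term_def fn h1 r1 a_def b_def g_def ..
  have t3: "domb_term m j = f ^ 2 * a ^ 3 * ((N - x) * ((N + 1 - x) * b)) ^ 3 * g * h"
    unfolding domb_term_def f_def r2 a_def b_def g_def h_def n_def by (simp add: algebra_simps)
  have shift: "int n + 1 - int (Suc j) = int n - int j" "int (Suc j) - 1 = int j"
    "int (Suc j) = int j + 1" "int n - (int j + 1) = int n - int j - 1"
    by simp_all
  have c1: "domb_cert n (Suc j) =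
     (8 * (x + 1) ^ 3 - 24 * (x + 1) ^ 2 + 22 * (x + 1) - 4
       + N * (- 36 * (x + 1) ^ 2 + 74 * (x + 1) - 32)
       + N ^ 2 * (52 * (x + 1) - 52) - 24 * N ^ 3) *
     ((N * f) ^ 2 * a ^ 3 * ((N + 1 - x) * b) ^ 3 * ((4 * x + 2) * g) * h)"
  proof -
    have "real (Suc j) = x + 1" by (simp add: x_def)
    then show ?thesis
      unfolding domb_cert_def shift(1,2) r1 fn shift(3,4)[symmetric]
      by (simp only: shift(3,4) h3 a_def h_def N_def)
  qed
  have c0: "domb_cert n j =
     (8 * x ^ 3 - 24 * x ^ 2 + 22 * x - 4 + N * (- 36 * x ^ 2 + 74 * x - 32)
       + N ^ 2 * (52 * x - 52) - 24 * N ^ 3) *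
     ((N * f) ^ 2 * (x * a) ^ 3 * b ^ 3 * g * ((4 * (N - x) - 2) * h))"
    unfolding domb_cert_def r3 fn h1 a_def b_def g_def x_def N_def ..
  show ?thesis
    unfolding t1 t2 t3 c1 c0 N_def[symmetric] by algebra
qed

lemma u_recurrence:
  fixes m :: nat
  defines "n \<equiv> m + 1"
  shows "(real n + 1) ^ 3 * real (u (n + 1)) =
    (2 * real n + 1) * (10 * real n ^ 2 + 10 * real n + 4) * real (u n) - 64 * real n ^ 3 * real (u m)"
proof -
  have "(real n + 1) ^ 3 * real (u (n + 1))
      - (2 * real n + 1) * (10 * real n ^ 2 + 10 * real n + 4) * real (u n)
      + 64 * real n ^ 3 * real (u m)
    = (\<Sum>j\<le>n + 1. domb_cert n (Suc j) - domb_cert n j)"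
    unfolding domb_term_telescopes[of m, folded n_def, symmetric]
      sum.distrib sum_subtractf sum_distrib_left[symmetric]
    by (simp add: u_eq_sum_domb_term[of _ "Suc n"] n_def)
  also have "\<dots> = domb_cert n (Suc (n + 1)) - domb_cert n 0"
    by (simp add: sum_lessThan_telescope flip: lessThan_Suc_atMost)
  \<comment> \<open>Both ends contain \<open>rfact (-1) = 0\<close>: from
    \<open>rfact (int j - 1)\<close> at \<open>j = 0\<close> and from
    \<open>rfact (int n + 1 - int j)\<close> at \<open>j = n + 2\<close>.\<close>
  also have "\<dots> = 0"
    by (simp add: domb_cert_def)
  finally show ?thesis by simp
qed

section \<open>Contiguity relations for the inner sum\<close>

text \<open>\<open>inner_sum\<close> is the inner sum over \<open>n = k + i\<close> of the double sum, for \<open>q = p - 2k\<close> and \<open>r = 2k\<close>, up to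
  factors depending on \<open>p\<close> and \<open>k\<close> only. It has no closed form; its contiguity relations, being free of
  denominators in the directions needed, replace one.\<close>
definition inner_term :: "int \<Rightarrow> nat \<Rightarrow> nat \<Rightarrow> real" where
  "inner_term q r i = fact (r + i) * rfact (int i) ^ 2 * rfact (q - int i)"

definition inner_sum :: "int \<Rightarrow> nat \<Rightarrow> real" where
  "inner_sum q r = (\<Sum>i\<le>nat q. inner_term q r i)"

lemma inner_sum_eq_sum:
  assumes "nat q \<le> M"
  shows "inner_sum q r = (\<Sum>i\<le>M. inner_term q r i)"
  unfolding inner_sum_def using assms
  by (intro sum.mono_neutral_left) (auto simp: inner_term_def rfact_def split: if_splits)

lemma inner_sum_neg: "q < 0 \<Longrightarrow> inner_sum q r = 0"
  by (simp add: inner_sum_def inner_term_def)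

text \<open>Termwise, \<open>fact (Suc r + i)\<close> brings in
  \<open>r + 1 + i = (r + 1 + q) - (q - i)\<close>, and the factor \<open>q - i\<close> lowers the
  argument of \<open>rfact (q - int i)\<close> by one.\<close>

lemma inner_sum_Suc_right: "inner_sum q (Suc r) = (real r + 1 + of_int q) * inner_sum q r - inner_sum (q - 1) r"
proof -
  define M where "M = nat q"
  have term_eq: "inner_term q (Suc r) i =
      (real r + 1 + of_int q) * inner_term q r i - inner_term (q - 1) r i" for i
  proof -
    have "rfact (q - 1 - int i) = (of_int q - real i) * rfact (q - int i)"
      using rfact_minus_one[of "q - int i"] by (simp add: algebra_simps)
    then show ?thesis
      unfolding inner_term_def by (simp only:) (simp add: algebra_simps)
  qed
  show ?thesis
    using inner_sum_eq_sum[of q M] inner_sum_eq_sum[of "q - 1" M]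
    by (simp add: M_def term_eq sum_subtractf sum_distrib_left)
qed

text \<open>Zeilberger's method in \<open>q\<close>. Stepping downwards divides only by
  \<open>2\<close>; stepping upwards would divide by \<open>(q + 1) ^ 2\<close>, which vanishes at
  \<open>q = -1\<close>.\<close>

lemma inner_sum_minus_one:
  "2 * inner_sum (q - 1) r =
     (3 * of_int q + real r + 2) * inner_sum q r - (of_int q + 1) ^ 2 * inner_sum (q + 1) r"
proof -
  define M where "M = nat (q + 1)"
  \<comment> \<open>The certificate is \<open>i ^ 2 * inner_term (q + 1) r i\<close>, with
    \<open>i\<close> absorbed into \<open>rfact\<close>.\<close>
  define c where "c i = fact (r + i) * rfact (int i - 1) ^ 2 * rfact (q + 1 - int i)" for i
  have term_eq: "(3 * of_int q + real r + 2) * inner_term q r i - (of_int q + 1) ^ 2 * inner_term (q + 1) r i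
      - 2 * inner_term (q - 1) r i = c (Suc i) - c i" for i
  proof -
    define a where "a = rfact (q + 1 - int i)"
    define b where "b = rfact (int i)"
    define f where "f = (fact (r + i) :: real)"
    have r1: "rfact (q - int i) = (of_int q + 1 - real i) * a"
      using rfact_minus_one[of "q + 1 - int i"] by (simp add: a_def)
    have r2: "rfact (q - 1 - int i) = (of_int q - real i) * ((of_int q + 1 - real i) * a)"
      using rfact_minus_one[of "q - int i"] r1 by (simp add: algebra_simps)
    have r3: "rfact (int i - 1) = real i * b"
      using rfact_minus_one[of "int i"] by (simp add: b_def)
    have c: "c (Suc i) = (real r + real i + 1) * f * b ^ 2 * ((of_int q + 1 - real i) * a)"
    proof -
      have "q + 1 - int (Suc i) = q - int i" "int (Suc i) - 1 = int i"
        "fact (r + Suc i) = (real r + real i + 1) * f"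
        by (simp_all add: f_def algebra_simps)
      then show ?thesis
        unfolding c_def b_def by (simp only: r1)
    qed
    show ?thesis
      unfolding c unfolding c_def inner_term_def r1 r2 r3 unfolding a_def[symmetric] b_def[symmetric] f_def[symmetric]
      by algebra
  qed
  have "(3 * of_int q + real r + 2) * inner_sum q r - (of_int q + 1) ^ 2 * inner_sum (q + 1) r - 2 * inner_sum (q - 1) r
      = (\<Sum>i\<le>M. c (Suc i) - c i)"
    unfolding term_eq[symmetric] sum_subtractf sum_distrib_left[symmetric]
    using inner_sum_eq_sum[of q M] inner_sum_eq_sum[of "q - 1" M] inner_sum_eq_sum[of "q + 1" M]
    by (simp add: M_def)
  also have "\<dots> = c (Suc M) - c 0"
    by (simp add: sum_lessThan_telescope flip: lessThan_Suc_atMost)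
  \<comment> \<open>\<open>c 0\<close> contains \<open>rfact (-1)\<close>, and
    \<open>c (Suc M)\<close> contains \<open>rfact (q - M)\<close> with \<open>q < M\<close>, even
    for negative \<open>q\<close>.\<close>
  also have "\<dots> = 0"
    by (simp add: c_def M_def)
  finally show ?thesis by simp
qed

section \<open>Creative telescoping in the outer index\<close>

definition lhs_coeff_term :: "nat \<Rightarrow> nat \<Rightarrow> real" where
  "lhs_coeff_term n k = hfac (int n - int k) * inner_sum (int n - 2 * int k) (2 * k) / fact k ^ 3"

text \<open>An ansatz with polynomial multiples of two neighbouring inner sums suffices; the polynomials
  solve a linear system, as for \<open>domb_cert\<close>.\<close>
definition lhs_coeff_cert :: "nat \<Rightarrow> nat \<Rightarrow> real" where
  "lhs_coeff_cert n k = hfac (int n - int k) * real k / fact k ^ 3 *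
     ((4 - 24 * real k + 32 * real k ^ 2 + real n * (20 - 104 * real k + 96 * real k ^ 2)
         + real n ^ 2 * (28 - 80 * real k) + 12 * real n ^ 3) * inner_sum (int n - 2 * int k + 1) (2 * k)
      + (- 8 + 16 * real k + real n * (- 32 + 64 * real k) - 24 * real n ^ 2)
         * inner_sum (int n - 2 * int k) (2 * k))"

lemma lhs_coeff_term_telescopes:
  fixes m k :: nat
  defines "n \<equiv> m + 1"
  shows "(real n + 1) ^ 3 * lhs_coeff_term (n + 1) k
    - (2 * real n + 1) * (10 * real n ^ 2 + 10 * real n + 4) * lhs_coeff_term n k
    + 64 * real n ^ 3 * lhs_coeff_term m k = lhs_coeff_cert n (Suc k) - lhs_coeff_cert n k"
proof -
  define q where "q = int n - 2 * int k"
  define N where "N = real n"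
  define x where "x = real k"
  \<comment> \<open>All inner sums reduce to the pair \<open>X\<close>, \<open>Y\<close>. Passing to
    \<open>k + 1\<close> lowers \<open>q\<close> by 2 and raises \<open>r\<close> by 2; each raise
    of \<open>r\<close> reaches one step lower in \<open>q\<close>, hence \<open>Z1\<close> to
    \<open>Z4\<close>.\<close>
  define X where "X = inner_sum (q + 1) (2 * k)"
  define Y where "Y = inner_sum q (2 * k)"
  define h where "h = hfac (int n - int k - 1)"
  define f where "f = 1 / (fact k :: real)"
  define Z1 where "Z1 = inner_sum (q - 1) (2 * k)"
  define Z2 where "Z2 = inner_sum (q - 2) (2 * k)"
  define Z3 where "Z3 = inner_sum (q - 3) (2 * k)"
  define Z4 where "Z4 = inner_sum (q - 4) (2 * k)"
  have q: "of_int q = N - 2 * x" by (simp add: q_def N_def x_def)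
  have k2: "real (2 * k) = 2 * x" by (simp add: x_def)
  have Z: "2 * Z1 = (3 * (N - 2 * x) + 2 * x + 2) * Y - (N - 2 * x + 1) ^ 2 * X"
    "2 * Z2 = (3 * (N - 2 * x - 1) + 2 * x + 2) * Z1 - (N - 2 * x) ^ 2 * Y"
    "2 * Z3 = (3 * (N - 2 * x - 2) + 2 * x + 2) * Z2 - (N - 2 * x - 1) ^ 2 * Z1"
    "2 * Z4 = (3 * (N - 2 * x - 3) + 2 * x + 2) * Z3 - (N - 2 * x - 2) ^ 2 * Z2"
    using inner_sum_minus_one[of q "2 * k"] inner_sum_minus_one[of "q - 1" "2 * k"]
      inner_sum_minus_one[of "q - 2" "2 * k"] inner_sum_minus_one[of "q - 3" "2 * k"]
    unfolding Z1_def Z2_def Z3_def Z4_def X_def Y_def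
    by (simp_all add: q k2[simplified])
  have up1: "inner_sum z (2 * k + 1) = (2 * x + 1 + of_int z) * inner_sum z (2 * k) - inner_sum (z - 1) (2 * k)" for z
    using inner_sum_Suc_right[of z "2 * k"] by (simp add: x_def)
  have up2: "inner_sum z (2 * Suc k) = (2 * x + 2 + of_int z) * inner_sum z (2 * k + 1) - inner_sum (z - 1) (2 * k + 1)" for z
    using inner_sum_Suc_right[of z "2 * k + 1"] by (simp add: x_def)
  have A: "inner_sum (q - 1) (2 * Suc k) = (2 * x + 1 + (N - 2 * x)) * ((2 * x + (N - 2 * x)) * Z1 - Z2)
      - ((2 * x + (N - 2 * x) - 1) * Z2 - Z3)"
    unfolding up2 up1 Z1_def Z2_def Z3_def by (simp add: q)
  have B: "inner_sum (q - 2) (2 * Suc k) = (2 * x + (N - 2 * x)) * ((2 * x + (N - 2 * x) - 1) * Z2 - Z3)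
      - ((2 * x + (N - 2 * x) - 2) * Z3 - Z4)"
    unfolding up2 up1 Z2_def Z3_def Z4_def by (simp add: q)
  have h1: "hfac (int n - int k) = (4 * (N - x) - 2) * h"
    using hfac_eq_minus_one[of "int n - int k"] by (simp add: h_def N_def x_def)
  have h2: "hfac (int n + 1 - int k) = (4 * (N - x) + 2) * ((4 * (N - x) - 2) * h)"
    using hfac_plus_one[of "int n - int k"] h1 by (simp add: N_def x_def algebra_simps)
  have shift: "int (n + 1) - int k = int n + 1 - int k" "int (n + 1) - 2 * int k = q + 1"
    "int n - 2 * int k = q" "int m - int k = int n - int k - 1" "int m - 2 * int k = q - 1"
    "int n - int (Suc k) = int n - int k - 1" "int n - 2 * int (Suc k) + 1 = q - 1"
    "int n - 2 * int (Suc k) = q - 2"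
    by (simp_all add: q_def n_def)
  have t1: "lhs_coeff_term (n + 1) k = (4 * (N - x) + 2) * ((4 * (N - x) - 2) * h) * X * f ^ 3"
    unfolding lhs_coeff_term_def shift h2 X_def f_def by (simp add: field_simps)
  have t2: "lhs_coeff_term n k = (4 * (N - x) - 2) * h * Y * f ^ 3"
    unfolding lhs_coeff_term_def shift h1 Y_def f_def by (simp add: field_simps)
  have t3: "lhs_coeff_term m k = h * Z1 * f ^ 3"
    unfolding lhs_coeff_term_def shift h_def Z1_def f_def by (simp add: field_simps)
  have c0: "lhs_coeff_cert n k = (4 * (N - x) - 2) * h * x * f ^ 3 *
     ((4 - 24 * x + 32 * x ^ 2 + N * (20 - 104 * x + 96 * x ^ 2)
         + N ^ 2 * (28 - 80 * x) + 12 * N ^ 3) * X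
      + (- 8 + 16 * x + N * (- 32 + 64 * x) - 24 * N ^ 2) * Y)"
    unfolding lhs_coeff_cert_def shift h1 X_def Y_def f_def N_def x_def by (simp add: power_divide)
  have f1: "real (Suc k) / fact (Suc k) ^ 3 = f ^ 3 / (x + 1) ^ 2"
    by (simp add: f_def x_def divide_simps) (simp add: power2_eq_square power3_eq_cube add.commute)
  have c1: "(x + 1) ^ 2 * lhs_coeff_cert n (Suc k) = h * f ^ 3 *
     ((4 - 24 * (x + 1) + 32 * (x + 1) ^ 2 + N * (20 - 104 * (x + 1) + 96 * (x + 1) ^ 2)
         + N ^ 2 * (28 - 80 * (x + 1)) + 12 * N ^ 3) * inner_sum (q - 1) (2 * Suc k)
      + (- 8 + 16 * (x + 1) + N * (- 32 + 64 * (x + 1)) - 24 * N ^ 2) * inner_sum (q - 2) (2 * Suc k))"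
  proof -
    have "real (Suc k) = x + 1" "x + 1 \<noteq> 0" by (simp_all add: x_def)
    then show ?thesis
      unfolding lhs_coeff_cert_def shift h_def[symmetric] N_def[symmetric] times_divide_eq_right[symmetric] f1
      by (simp del: of_nat_Suc mult_Suc_right)
  qed
  \<comment> \<open>Multiplying by \<open>(x + 1) ^ 2\<close> clears the denominator left by
    \<open>Suc k / fact (Suc k) ^ 3\<close>, so polynomial arithmetic modulo the relations
    \<open>Z\<close> suffices.\<close>
  have "(x + 1) ^ 2 * ((N + 1) ^ 3 * lhs_coeff_term (n + 1) k
    - (2 * N + 1) * (10 * N ^ 2 + 10 * N + 4) * lhs_coeff_term n k
    + 64 * N ^ 3 * lhs_coeff_term m k) = (x + 1) ^ 2 * (lhs_coeff_cert n (Suc k) - lhs_coeff_cert n k)"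
    unfolding right_diff_distrib[of _ "lhs_coeff_cert n (Suc k)"] c1 A B c0 t1 t2 t3
    using Z by algebra
  moreover have "(x + 1) ^ 2 \<noteq> 0" by (simp add: x_def)
  ultimately show ?thesis
    unfolding N_def by (simp only: mult_cancel_left) simp
qed

section \<open>Coefficients of the triple series and their recurrence\<close>

text \<open>Here \<open>m\<close> is the exponent from expanding \<open>(1 - 4x)^(-n-1/2)\<close>;
  the first two factors are the coefficient of that expansion times \<open>2 * n choose n\<close>,
  by \<open>binomial_series_coeff\<close>.\<close>

definition triple_coeff :: "nat \<Rightarrow> nat \<Rightarrow> nat \<Rightarrow> nat" where
  "triple_coeff n k m = (2 * (n + m) choose (n + m)) * (n + m choose m) * ((n choose k)\<^sup>2 * (n + k choose k))"

definition lhs_coeff :: "nat \<Rightarrow> nat" where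
  "lhs_coeff p = (\<Sum>(k, n)\<in>(SIGMA k:{..p}. {..p - k}). triple_coeff n k (p - k - n))"

lemma lhs_coeff_term_eq_0: "k > n \<Longrightarrow> lhs_coeff_term n k = 0"
  by (simp add: lhs_coeff_term_def inner_sum_neg)

lemma lhs_coeff_term_eq:
  assumes "k \<le> p"
  shows "lhs_coeff_term p k = real (\<Sum>n\<le>p - k. triple_coeff n k (p - k - n))"
proof (cases "2 * k \<le> p")
  case False
  then have "n choose k = 0" if "n \<le> p - k" for n
    using that by (intro binomial_eq_0) auto
  then show ?thesis
    using False by (simp add: lhs_coeff_term_def inner_sum_neg triple_coeff_def del: binomial_eq_0_iff)
next
  case True
  define s where "s = p - 2 * k"
  have p: "p = s + 2 * k" using True by (simp add: s_def)
  have coeff: "real (triple_coeff (k + i) k (s - i)) =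
      fact (2 * (s + k)) / fact (s + k) * inner_term (int s) (2 * k) i / fact k ^ 3"
    if "i \<le> s" for i
  proof -
    obtain t where t: "s = i + t" using le_Suc_ex[OF \<open>i \<le> s\<close>] by blast
    \<comment> \<open>\<open>F\<close> cancels: the squared \<open>k + i choose k\<close> gives
      \<open>F ^ 2\<close>, and two other binomials give \<open>1 / F\<close> each.\<close>
    define F where "F = (fact (k + i) :: real)"
    have "real (2 * (k + i + t) choose (k + i + t)) = fact (2 * (k + i + t)) / (fact (k + i + t) * fact (k + i + t))"
      "real (k + i + t choose t) = fact (k + i + t) / (fact t * F)"
      "real (k + i choose k) = F / (fact k * fact i)"
      "real (k + i + k choose k) = fact (2 * k + i) / (fact k * F)"
      by (simp_all add: binomial_fact F_def mult_2 add_ac)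
    moreover have "int s - int i = int t" "s + k = k + i + t" "s - i = t"
      by (simp_all add: t)
    moreover have "F \<noteq> 0"
      by (simp add: F_def)
    ultimately show ?thesis
      by (simp add: triple_coeff_def inner_term_def power2_eq_square power3_eq_cube add_ac mult_ac)
  qed
  have "(\<Sum>n\<le>p - k. triple_coeff n k (p - k - n)) = (\<Sum>n\<in>{k..p - k}. triple_coeff n k (p - k - n))"
    by (intro sum.mono_neutral_right) (auto simp: triple_coeff_def)
  also have "\<dots> = (\<Sum>i\<le>s. triple_coeff (k + i) k (s - i))"
    by (rule sum.reindex_bij_witness[of _ "\<lambda>i. k + i" "\<lambda>n. n - k"]) (auto simp: p add.commute)
  finally have "real (\<Sum>n\<le>p - k. triple_coeff n k (p - k - n)) =
      (\<Sum>i\<le>s. fact (2 * (s + k)) / fact (s + k) * inner_term (int s) (2 * k) i / fact k ^ 3)"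
    by (simp add: coeff)
  also have "\<dots> = hfac (int (s + k)) * inner_sum (int s) (2 * k) / fact k ^ 3"
    by (simp only: inner_sum_def hfac_of_nat nat_int sum_distrib_left sum_divide_distrib)
  also have "\<dots> = lhs_coeff_term p k"
    by (simp add: lhs_coeff_term_def p add.commute)
  finally show ?thesis ..
qed

lemma lhs_coeff_eq_sum_lhs_coeff_term:
  assumes "p \<le> M"
  shows "real (lhs_coeff p) = (\<Sum>k\<le>M. lhs_coeff_term p k)"
proof -
  have "lhs_coeff p = (\<Sum>k\<le>p. \<Sum>n\<le>p - k. triple_coeff n k (p - k - n))"
    by (simp add: lhs_coeff_def sum.Sigma)
  then have "real (lhs_coeff p) = (\<Sum>k\<le>p. lhs_coeff_term p k)"
    by (simp add: lhs_coeff_term_eq)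
  also have "\<dots> = (\<Sum>k\<le>M. lhs_coeff_term p k)"
    using assms by (intro sum.mono_neutral_left) (auto simp: lhs_coeff_term_eq_0)
  finally show ?thesis .
qed

lemma lhs_coeff_recurrence:
  fixes m :: nat
  defines "n \<equiv> m + 1"
  shows "(real n + 1) ^ 3 * real (lhs_coeff (n + 1)) =
    (2 * real n + 1) * (10 * real n ^ 2 + 10 * real n + 4) * real (lhs_coeff n) - 64 * real n ^ 3 * real (lhs_coeff m)"
proof -
  have "(real n + 1) ^ 3 * real (lhs_coeff (n + 1))
      - (2 * real n + 1) * (10 * real n ^ 2 + 10 * real n + 4) * real (lhs_coeff n)
      + 64 * real n ^ 3 * real (lhs_coeff m)
    = (\<Sum>k\<le>n + 1. lhs_coeff_cert n (Suc k) - lhs_coeff_cert n k)"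
    unfolding lhs_coeff_term_telescopes[of m, folded n_def, symmetric]
      sum.distrib sum_subtractf sum_distrib_left[symmetric]
    by (simp add: lhs_coeff_eq_sum_lhs_coeff_term[of _ "Suc n"] n_def)
  also have "\<dots> = lhs_coeff_cert n (Suc (n + 1)) - lhs_coeff_cert n 0"
    by (simp add: sum_lessThan_telescope flip: lessThan_Suc_atMost)
  \<comment> \<open>At \<open>k = 0\<close> the factor \<open>real k\<close> vanishes; at
    \<open>k = n + 2\<close> both inner sums have a negative first argument.\<close>
  also have "\<dots> = 0"
    by (simp add: lhs_coeff_cert_def inner_sum_neg)
  finally show ?thesis by simp
qed

section \<open>Agreement of the two coefficient sequences\<close>

text \<open>The telescoped recurrences cover only indices \<open>m + 1\<close>; at index
  \<open>0\<close> the recurrence reads \<open>v 1 = 4 * v 0\<close>, which the two initial values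
  provide.\<close>

lemma satisfies_rec_of_nat:
  fixes w :: "nat \<Rightarrow> nat"
  assumes "w 0 = 1" "w 1 = 4"
    and rec: "\<And>m. (real (m + 1) + 1) ^ 3 * real (w (m + 1 + 1)) =
      (2 * real (m + 1) + 1) * (10 * real (m + 1) ^ 2 + 10 * real (m + 1) + 4) * real (w (m + 1))
        - 64 * real (m + 1) ^ 3 * real (w m)"
  shows "satisfies_rec (\<lambda>n. of_nat (w n))"
proof -
  have "(of_nat n + 1) ^ 3 * of_nat (w (n + 1)) =
        (2 * of_nat n + 1) * (10 * of_nat n ^ 2 + 10 * of_nat n + 4) * of_nat (w n)
          - 64 * of_nat n ^ 3 * (of_nat (w (n - 1)) :: complex)" for n
  proof (cases n)
    case 0
    then show ?thesis using assms(1,2) by simp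
  next
    case (Suc m)
    then have n: "n = m + 1" by simp
    show ?thesis
      using arg_cong[OF rec[of m], of complex_of_real] unfolding n by simp
  qed
  then show ?thesis
    using assms(1) by (simp add: satisfies_rec_def)
qed

lemma satisfies_rec_unique:
  assumes "satisfies_rec v" "satisfies_rec w"
  shows "v = w"
proof
  fix n
  show "v n = w n"
  proof (induction n rule: less_induct)
    case (less n)
    show ?case
    proof (cases n)
      case 0
      then show ?thesis using assms by (simp add: satisfies_rec_def)
    next
      case (Suc m)
      have "v m = w m" "v (m - 1) = w (m - 1)"
        using less Suc by auto
      then have "(of_nat m + 1) ^ 3 * v (m + 1) = (of_nat m + 1) ^ 3 * w (m + 1)"
        using assms unfolding satisfies_rec_def by metis
      moreover have "(of_nat m + 1 :: complex) \<noteq> 0"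
        using of_nat_neq_0[of m] by (simp add: add.commute)
      ultimately show ?thesis by (simp add: Suc)
    qed
  qed
qed

lemma satisfies_rec_u: "satisfies_rec (\<lambda>n. of_nat (u n))"
  by (rule satisfies_rec_of_nat[OF _ _ u_recurrence]) (simp_all add: u_def numeral_2_eq_2)

lemma satisfies_rec_lhs_coeff: "satisfies_rec (\<lambda>n. of_nat (lhs_coeff n))"
proof (rule satisfies_rec_of_nat[OF _ _ lhs_coeff_recurrence])
  show "lhs_coeff 0 = 1"
    by (simp add: lhs_coeff_def triple_coeff_def sum.Sigma[symmetric])
  show "lhs_coeff 1 = 4"
    by (simp add: lhs_coeff_def triple_coeff_def sum.Sigma[symmetric] numeral_2_eq_2)
qed

lemma lhs_coeff_eq_u: "lhs_coeff = u"
proof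
  show "lhs_coeff n = u n" for n
    using fun_cong[OF satisfies_rec_unique[OF satisfies_rec_lhs_coeff satisfies_rec_u], of n]
    by (simp only: of_nat_eq_iff)
qed

section \<open>Growth bound and binomial series\<close>

text \<open>The central binomials contribute at most \<open>4 ^ j * 4 ^ (n - j)\<close>, and the
  squares sum to \<open>2 * n choose n\<close>, at most \<open>4 ^ n\<close>. This yields the radius
  \<open>1 / 16\<close>.\<close>

lemma u_le: "u n \<le> 16 ^ n"
proof -
  have "u n \<le> (\<Sum>j=0..n. (n choose j)\<^sup>2 * 2 ^ (2 * j) * 2 ^ (2 * n - 2 * j))"
    unfolding u_def by (intro sum_mono mult_mono binomial_le_pow2) auto
  also have "\<dots> = (\<Sum>j=0..n. 2 ^ (2 * n) * (n choose j)\<^sup>2)"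
    by (intro sum.cong) (auto simp: mult.assoc simp flip: power_add)
  also have "\<dots> = 2 ^ (2 * n) * (2 * n choose n)"
    by (simp add: choose_square_sum flip: sum_distrib_left atMost_atLeast0)
  also have "\<dots> \<le> 2 ^ (2 * n) * 2 ^ (2 * n)"
    by (intro mult_left_mono binomial_le_pow2) auto
  also have "\<dots> = 16 ^ n"
    by (simp add: power_mult flip: power_mult_distrib)
  finally show ?thesis .
qed

text \<open>Both sides gain the factor \<open>(4 * (n + m) + 2) / (m + 1)\<close> when
  \<open>m\<close> grows by one.\<close>

lemma binomial_series_coeff:
  "of_nat (2 * n choose n) * ((- (of_nat n + 1 / 2) :: complex) gchoose m) * (- 4) ^ m =
     of_nat ((2 * (n + m) choose (n + m)) * (n + m choose m))"
proof (induction m)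
  case 0
  then show ?case by simp
next
  case (Suc m)
  define e where "e m = (2 * (n + m) choose (n + m)) * (n + m choose m)" for m
  define a where "a = (- (of_nat n + 1 / 2) :: complex)"
  have e: "real (e m) = hfac (int (n + m)) / (fact n * fact m)" for m
  proof -
    have "real (2 * (n + m) choose (n + m)) = fact (2 * (n + m)) / (fact (n + m) * fact (n + m))"
      "real (n + m choose m) = fact (n + m) / (fact m * fact n)"
      by (simp_all add: binomial_fact add.commute)
    then show ?thesis
      unfolding e_def of_nat_mult hfac_of_nat by (simp only:) simp
  qed
  have "real (Suc m) * real (e (Suc m)) = (4 * real (n + m) + 2) * real (e m)"
  proof -
    have "int (n + Suc m) = int (n + m) + 1" by simp
    then have "hfac (int (n + Suc m)) = (4 * real (n + m) + 2) * hfac (int (n + m))"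
      using hfac_plus_one[of "int (n + m)"] by (simp only: of_int_of_nat_eq)
    then show ?thesis
      unfolding e fact_Suc by (simp only:) (simp del: of_nat_Suc of_nat_add)
  qed
  from arg_cong[OF this, of complex_of_real]
  have "of_nat (Suc m) * of_nat (e (Suc m)) = (4 * of_nat (n + m) + 2) * (of_nat (e m) :: complex)"
    by simp
  also have "of_nat (e m) = of_nat (2 * n choose n) * (a gchoose m) * (- 4) ^ m"
    using Suc by (simp add: e_def a_def)
  also have "(4 * of_nat (n + m) + 2) * \<dots> =
      of_nat (2 * n choose n) * (- 4) ^ Suc m * ((a - of_nat m) * (a gchoose m))"
    by (simp add: a_def algebra_simps)
  also have "(a - of_nat m) * (a gchoose m) = of_nat (Suc m) * (a gchoose Suc m)"
    using gbinomial_mult_1[of a m] by (simp add: algebra_simps)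
  finally have "of_nat (Suc m) * (of_nat (e (Suc m)) :: complex) =
      of_nat (Suc m) * (of_nat (2 * n choose n) * (a gchoose Suc m) * (- 4) ^ Suc m)"
    by (simp only: mult_ac)
  then show ?case
    unfolding e_def a_def using of_nat_neq_0[of m, where 'a = complex]
    by (simp only: mult_cancel_left) simp
qed

lemma binomial_series_sums:
  fixes x :: complex
  assumes "norm x < 1 / 4"
  shows "(\<lambda>m. of_nat ((2 * (n + m) choose (n + m)) * (n + m choose m)) * x ^ m) sums
    (of_nat (2 * n choose n) / (1 - 4 * x) powr (of_nat n + 1 / 2))"
proof -
  have "(\<lambda>m. (- (of_nat n + 1 / 2) gchoose m) * (- 4 * x) ^ m) sums (1 + - 4 * x) powr (- (of_nat n + 1 / 2))"
    by (rule gen_binomial_complex) (use assms in \<open>simp add: norm_mult\<close>)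
  then have "(\<lambda>m. of_nat (2 * n choose n) * ((- (of_nat n + 1 / 2) gchoose m) * (- 4 * x) ^ m)) sums
      (of_nat (2 * n choose n) * (1 + - 4 * x) powr (- (of_nat n + 1 / 2)))"
    by (rule sums_mult)
  also have "(\<lambda>m. of_nat (2 * n choose n) * ((- (of_nat n + 1 / 2) gchoose m) * (- 4 * x) ^ m)) =
      (\<lambda>m. of_nat ((2 * (n + m) choose (n + m)) * (n + m choose m)) * x ^ m)"
    unfolding binomial_series_coeff[symmetric] power_mult_distrib by (simp only: mult_ac)
  also have "of_nat (2 * n choose n) * (1 + - 4 * x) powr (- (of_nat n + 1 / 2)) =
      of_nat (2 * n choose n) / (1 - 4 * x) powr (of_nat n + 1 / 2)"
    unfolding powr_minus_divide by simp
  finally show ?thesis .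
qed

section \<open>Rearranging the triple series\<close>

definition triple_monom :: "complex \<Rightarrow> nat \<times> nat \<times> nat \<Rightarrow> complex" where
  "triple_monom x = (\<lambda>(n, k, m). of_nat (triple_coeff n k m) * x ^ (n + k + m))"

text \<open>Triples \<open>(n, k, m)\<close> by total degree \<open>p = n + k + m\<close>, stored as
  \<open>(p, k, n)\<close>; the bounds make \<open>m = p - k - n\<close> an exact
  subtraction.\<close>

abbreviation degree_fibres :: "(nat \<times> nat \<times> nat) set" where
  "degree_fibres \<equiv> SIGMA p:UNIV. SIGMA k:{..p}. {..p - k}"

lemma summable_u_power:
  fixes x :: complex
  assumes "norm x < 1 / 16"
  shows "(\<lambda>p. norm (of_nat (u p) * x ^ p)) summable_on UNIV"
    "summable (\<lambda>p. of_nat (u p) * x ^ p)"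
proof -
  have "summable (\<lambda>p. norm (of_nat (u p) * x ^ p))"
  proof (rule summable_comparison_test)
    show "summable (\<lambda>p. (16 * norm x) ^ p)"
      using assms by (intro summable_geometric) simp
    have "real (u p) \<le> 16 ^ p" for p
      using u_le[of p] by (metis of_nat_le_iff of_nat_numeral of_nat_power)
    then show "\<exists>N. \<forall>p\<ge>N. norm (norm (of_nat (u p) * x ^ p)) \<le> (16 * norm x) ^ p"
      by (auto simp: norm_mult norm_power power_mult_distrib intro!: mult_right_mono)
  qed
  then show "(\<lambda>p. norm (of_nat (u p) * x ^ p)) summable_on UNIV"
    "summable (\<lambda>p. of_nat (u p) * x ^ p)"
    by (auto intro: norm_summable_imp_summable_on summable_norm_cancel)
qed

text \<open>The semiring is arbitrary so as to allow both \<open>x\<close> and \<open>norm x\<close>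
  for \<open>y\<close>.\<close>

lemma sum_triple_coeff_degree:
  "(\<Sum>(k, n)\<in>(SIGMA k:{..p}. {..p - k}). of_nat (triple_coeff n k (p - k - n)) * y ^ p)
     = of_nat (u p) * (y :: 'a :: comm_semiring_1) ^ p"
  by (simp add: lhs_coeff_eq_u[symmetric] lhs_coeff_def sum_distrib_right split_def)

text \<open>Coefficients are nonnegative, so the norms in degree \<open>p\<close> add up to exactly
  \<open>u p * norm x ^ p\<close>, and absolute summability over triples reduces to that of a single
  series.\<close>

lemma
  fixes x :: complex
  assumes x: "norm x < 1 / 16"
  shows triple_monom_abs_summable: "(\<lambda>t. norm (triple_monom x t)) summable_on UNIV"
    and infsum_triple_monom: "infsum (triple_monom x) UNIV = (\<Sum>p. of_nat (u p) * x ^ p)"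
proof -
  define g where "g = (\<lambda>(p, k, n). of_nat (triple_coeff n k (p - k - n)) * x ^ p)"
  have "(\<lambda>t. norm (g t)) summable_on degree_fibres"
  proof (subst Infinite_Sum.abs_summable_on_Sigma_iff, intro conjI ballI)
    fix p show "(\<lambda>y. norm (g (p, y))) summable_on (SIGMA k:{..p}. {..p - k})"
      by (intro summable_on_finite) auto
  next
    have "infsum (\<lambda>y. norm (g (p, y))) (SIGMA k:{..p}. {..p - k}) = norm (of_nat (u p) * x ^ p)" for p
    proof -
      have "infsum (\<lambda>y. norm (g (p, y))) (SIGMA k:{..p}. {..p - k}) =
          (\<Sum>(k, n)\<in>(SIGMA k:{..p}. {..p - k}). of_nat (triple_coeff n k (p - k - n)) * norm x ^ p)"
        by (simp add: g_def norm_mult norm_power split_def)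
      then show ?thesis
        unfolding sum_triple_coeff_degree by (simp add: norm_mult norm_power)
    qed
    then show "(\<lambda>p. norm (infsum (\<lambda>y. norm (g (p, y))) (SIGMA k:{..p}. {..p - k}))) summable_on UNIV"
      using summable_u_power(1)[OF x] by simp
  qed
  also have "?this \<longleftrightarrow> (\<lambda>t. norm (triple_monom x t)) summable_on UNIV"
    by (rule summable_on_reindex_bij_witness
        [of _ "\<lambda>(n, k, m). (n + k + m, k, n)" "\<lambda>(p, k, n). (n, k, p - k - n)"])
      (auto simp: g_def triple_monom_def)
  finally show summable: "(\<lambda>t. norm (triple_monom x t)) summable_on UNIV" .
  have g: "g summable_on degree_fibres"
    using \<open>(\<lambda>t. norm (g t)) summable_on degree_fibres\<close> by (rule abs_summable_summable)
  have "infsum (triple_monom x) UNIV = infsum g degree_fibres"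
    by (rule infsum_reindex_bij_witness
        [of _ "\<lambda>(p, k, n). (n, k, p - k - n)" "\<lambda>(n, k, m). (n + k + m, k, n)"])
      (auto simp: g_def triple_monom_def)
  also have "\<dots> = (\<Sum>\<^sub>\<infinity>p. infsum (\<lambda>y. g (p, y)) (SIGMA k:{..p}. {..p - k}))"
    using infsum_Sigma'_banach[of "\<lambda>p y. g (p, y)" UNIV "\<lambda>p. SIGMA k:{..p}. {..p - k}"] g
    by (simp add: split_def del: infsum_finite)
  also have "\<dots> = (\<Sum>\<^sub>\<infinity>p. of_nat (u p) * x ^ p)"
    by (intro infsum_cong) (simp add: g_def flip: sum_triple_coeff_degree)
  also have "\<dots> = (\<Sum>p. of_nat (u p) * x ^ p)"
    using abs_summable_summable[OF summable_u_power(1)[OF x]]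
    by (metis has_sum_imp_sums has_sum_infsum sums_unique)
  finally show "infsum (triple_monom x) UNIV = (\<Sum>p. of_nat (u p) * x ^ p)" .
qed

lemma infsum_triple_monom_section:
  assumes x: "norm x < 1 / 16"
  shows "(\<Sum>\<^sub>\<infinity>y. triple_monom x (n, y)) = lhs_term x n"
proof -
  have "(\<lambda>(n, y). triple_monom x (n, y)) summable_on UNIV \<times> UNIV"
    using abs_summable_summable[OF triple_monom_abs_summable[OF x]] by simp
  from summable_on_SigmaD1[OF this, of n]
  have sec: "(\<lambda>(k, m). triple_monom x (n, k, m)) summable_on UNIV \<times> UNIV"
    by (simp add: split_def)
  have inner: "(\<Sum>\<^sub>\<infinity>m. triple_monom x (n, k, m)) =
      of_nat ((n choose k)\<^sup>2 * (n + k choose k)) * x ^ (n + k) *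
        (of_nat (2 * n choose n) / (1 - 4 * x) powr (of_nat n + 1 / 2))" (is "_ = ?S") for k
  proof -
    have "norm x < 1 / 4" using x by simp
    from sums_mult[OF binomial_series_sums[OF this, of n],
        of "of_nat ((n choose k)\<^sup>2 * (n + k choose k)) * x ^ (n + k)"]
    have "(\<lambda>m. triple_monom x (n, k, m)) sums ?S"
      by (simp add: triple_monom_def triple_coeff_def power_add mult_ac)
    moreover have "(\<lambda>m. triple_monom x (n, k, m)) sums (\<Sum>\<^sub>\<infinity>m. triple_monom x (n, k, m))"
      by (intro has_sum_imp_sums has_sum_infsum summable_on_SigmaD1[OF sec]) simp
    ultimately show ?thesis
      using sums_unique2 by blast
  qed
  have "(\<Sum>\<^sub>\<infinity>y. triple_monom x (n, y)) = (\<Sum>\<^sub>\<infinity>k. \<Sum>\<^sub>\<infinity>m. triple_monom x (n, k, m))"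
    using infsum_Sigma'_banach[OF sec] by (simp add: split_def)
  also have "\<dots> = (\<Sum>\<^sub>\<infinity>k\<in>{0..n}. of_nat ((n choose k)\<^sup>2 * (n + k choose k)) * x ^ (n + k) *
        (of_nat (2 * n choose n) / (1 - 4 * x) powr (of_nat n + 1 / 2)))"
    \<comment> \<open>Beyond \<open>k = n\<close> the factor \<open>n choose k\<close> is zero, so
      the sum over \<open>k\<close> becomes finite.\<close>
    unfolding inner by (intro infsum_cong_neutral) auto
  also have "\<dots> = lhs_term x n"
    by (simp add: lhs_term_def sum_distrib_left sum_divide_distrib power_add mult_ac)
  finally show ?thesis .
qed

text \<open>Fubini: grouping the absolutely summable triple series by \<open>n\<close> instead of by
  degree gives the same total.\<close>

lemma lhs_term_sums:
  assumes x: "norm x < 1 / 16"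
  shows "lhs_term x sums (\<Sum>p. of_nat (u p) * x ^ p)"
proof -
  have summable: "(\<lambda>(n, y). triple_monom x (n, y)) summable_on UNIV \<times> UNIV"
    using abs_summable_summable[OF triple_monom_abs_summable[OF x]] by simp
  have "lhs_term x summable_on UNIV" "infsum (lhs_term x) UNIV = infsum (triple_monom x) UNIV"
    using summable_on_Sigma_banach[OF summable] infsum_Sigma'_banach[OF summable]
    by (simp_all add: infsum_triple_monom_section[OF x])
  then show ?thesis
    using infsum_triple_monom[OF x] by (metis has_sum_imp_sums has_sum_infsum)
qed

theorem theorem5p1:
  shows "satisfies_rec (\<lambda>n. of_nat (u n)) \<and>
    (\<forall>v. satisfies_rec v \<longrightarrow> v = (\<lambda>n. of_nat (u n))) \<and>
    (\<exists>r>0. \<forall>x::complex. norm x < r \<longrightarrow>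
       summable (lhs_term x) \<and>
       summable (\<lambda>n. of_nat (u n) * x ^ n) \<and>
       (\<Sum>n. lhs_term x n) = (\<Sum>n. of_nat (u n) * x ^ n))"
proof (intro conjI allI impI exI[of _ "1 / 16"])
  show "satisfies_rec (\<lambda>n. of_nat (u n))"
    by (rule satisfies_rec_u)
  show "v = (\<lambda>n. of_nat (u n))" if "satisfies_rec v" for v
    using that satisfies_rec_u by (rule satisfies_rec_unique)
  fix x :: complex
  assume x: "norm x < 1 / 16"
  show "summable (lhs_term x)" "(\<Sum>n. lhs_term x n) = (\<Sum>n. of_nat (u n) * x ^ n)"
    using lhs_term_sums[OF x] by (simp_all add: sums_iff)
  show "summable (\<lambda>n. of_nat (u n) * x ^ n)"
    using x by (rule summable_u_power)
qed simp

end
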